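(* Let $G$ be a Tychonoff $k$-gentle paratopological group that is not locally compact. Then either every remainder of $G$ has the Baire property (i.e. is a Baire space), or every remainder of $G$ is $\sigma$-compact.
   Context: All spaces are assumed to be Tychonoff. A paratopological group is a group $G$ with a topology such that the product map $G\times G\to G$, $(x,y)\mapsto xy$, is jointly continuous (inversion is not assumed continuous). A map $f:X\to Y$ between spaces is $k$-gentle if for every compact subset $F$ of $X$ the image $f(F)$ is compact. A paratopological group $G$ is $k$-gentle if the inverse map $x\mapsto x^{-1}$ of $G$ to itself is $k$-gentle. A remainder of a space $X$ is the subspace $bX\setminus X$ of a Hausdorff compactification $bX$ of $X$. A space is Baire (has the Baire property) if the intersection of every sequence of open dense subsets is dense. *)

theory Defs
  imports "HOL-Analysis.Analysis" "HOL-Algebra.Group"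
begin

definition Tychonoff_space :: "'a topology \<Rightarrow> bool" where
  "Tychonoff_space X \<longleftrightarrow> completely_regular_space X \<and> Hausdorff_space X"

text \<open>No continuity of \<open>f\<close> is required: the case of interest is the inversion of a group,
  which need not be continuous.\<close>

definition k_gentle_map :: "'a topology \<Rightarrow> 'b topology \<Rightarrow> ('a \<Rightarrow> 'b) \<Rightarrow> bool" where
  "k_gentle_map X Y f \<longleftrightarrow>
     f \<in> topspace X \<rightarrow> topspace Y \<and> (\<forall>F. compactin X F \<longrightarrow> compactin Y (f ` F))"

locale paratopological_group = group G for G (structure) +
  fixes T :: "'a topology"
  assumes topspace_eq_carrier: "topspace T = carrier G"
    and continuous_mult: "continuous_map (prod_topology T T) T (\<lambda>(x, y). x \<otimes> y)"

locale k_gentle_paratopological_group = paratopological_group +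
  assumes k_gentle_inv: "k_gentle_map T T (\<lambda>x. inv x)"

definition Hausdorff_compactification :: "'a topology \<Rightarrow> 'b topology \<Rightarrow> ('a \<Rightarrow> 'b) \<Rightarrow> bool" where
  "Hausdorff_compactification X B e \<longleftrightarrow>
     compact_space B \<and> Hausdorff_space B \<and> embedding_map X B e \<and>
     B closure_of (e ` topspace X) = topspace B"

definition remainder :: "'a topology \<Rightarrow> 'b topology \<Rightarrow> ('a \<Rightarrow> 'b) \<Rightarrow> 'b topology" where
  "remainder X B e = subtopology B (topspace B - e ` topspace X)"

definition Baire_space :: "'a topology \<Rightarrow> bool" where
  "Baire_space X \<longleftrightarrow>
     (\<forall>U :: nat \<Rightarrow> 'a set. (\<forall>n. openin X (U n) \<and> X closure_of (U n) = topspace X) \<longrightarrow>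
        X closure_of (\<Inter>n. U n) = topspace X)"

definition sigma_compact_space :: "'a topology \<Rightarrow> bool" where
  "sigma_compact_space X \<longleftrightarrow>
     (\<exists>K :: nat \<Rightarrow> 'a set. (\<forall>n. compactin X (K n)) \<and> (\<Union>n. K n) = topspace X)"

text \<open>Pitfall: HOL cannot quantify over types inside a formula, so a single type variable for the
  carriers of all compactifications would let the alternative in a dichotomy ``all remainders are
  P or all remainders are Q'' depend on that type. Such a dichotomy must therefore use two
  independent type variables, one in each alternative: as \<open>'b\<close> and \<open>'c\<close> vary independently,
  the validity of \<open>A('b) \<or> B('c)\<close> for all \<open>'b\<close>, \<open>'c\<close> amounts to \<open>A\<close> holding for all types or
  \<open>B\<close> holding for all types.\<close>

end

theory Submission
  imports Defs
begin

text \<open>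
  Suppose that some remainder \<open>Y\<close> of \<open>G\<close> in \<open>bG\<close> is not Baire. As \<open>G\<close> is nowhere locally compact,
  \<open>Y\<close> is dense in \<open>bG\<close>, so there are open sets \<open>P\<^sub>n\<close>, dense in a nonempty open \<open>O\<close>, whose
  intersection lies in \<open>G\<close>. Nested sequences of open sets \<open>W\<^sub>n\<close> with closures in \<open>P\<^sub>n\<close> yield
  compact sets \<open>K = \<Inter>W\<^sub>n\<close> with countable neighbourhood base \<open>W\<^sub>n\<close> in \<open>G\<close>. Inversion is continuous
  on compact sets, and sequences \<open>a\<^sub>n \<in> W\<^sub>n\<close> together with \<open>K\<close> are compact, so inversion is
  continuous and \<open>G\<close> is a topological group.

  An ultrafilter on \<open>G\<close> that contains, for each \<open>n\<close>, a left and a right translate of \<open>W\<^sub>n\<close> is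
  Cauchy, by compactness of \<open>K\<close>. A Baire category argument gives \<open>x\<close> such that the translate
  \<open>F x\<close> of a Cauchy ultrafilter \<open>F\<close> converges in \<open>bG\<close> to a point of \<open>\<Inter>P\<^sub>n \<subseteq> G\<close>; hence \<open>F\<close>
  converges in \<open>G\<close>. In any compactification, \<open>G\<close> is therefore the intersection of the open sets
  \<open>E\<^sub>n\<close> of points near which \<open>G\<close> lies in a left and a right translate of \<open>W\<^sub>n\<close>, and the
  remainder is \<open>\<sigma>\<close>-compact.
\<close>

section \<open>Ultrafilters and convergence\<close>

text \<open>Ultrafilters play the part of subnets: inside a compact set each one converges outright.
  In the order of filters they are the minimal proper ones.\<close>

definition ultrafilter :: "'a filter \<Rightarrow> bool" where
  "ultrafilter F \<longleftrightarrow> F \<noteq> bot \<and> (\<forall>P. eventually P F \<or> eventually (\<lambda>x. \<not> P x) F)"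

lemma ultrafilter_nonbot: "ultrafilter F \<Longrightarrow> F \<noteq> bot"
  by (simp add: ultrafilter_def)

lemma ultrafilter_exhaust: "ultrafilter F \<Longrightarrow> eventually P F \<or> eventually (\<lambda>x. \<not> P x) F"
  by (simp add: ultrafilter_def)

text \<open>Zorn's lemma for the proper filters below \<open>F\<close>, ordered downwards. A minimal
  one decides every predicate, because restricting it to a set that it does not exclude gives back
  the same filter.\<close>

lemma ultrafilter_exists:
  assumes "F \<noteq> bot"
  obtains U where "U \<le> F" "ultrafilter U"
proof -
  let ?A = "{U. U \<le> F \<and> U \<noteq> bot}"
  have "\<exists>m\<in>?A. \<forall>a\<in>?A. m \<ge> a \<longrightarrow> a = m"
  proof (rule predicate_Zorn)
    show "partial_order_on ?A (relation_of (\<ge>) ?A)"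
      by (rule partial_order_on_relation_ofI) auto
  next
    fix C assume C: "C \<in> Chains (relation_of (\<ge>) ?A)"
    then have sub: "C \<subseteq> ?A" and chain: "\<And>U V. U \<in> C \<Longrightarrow> V \<in> C \<Longrightarrow> U \<le> V \<or> V \<le> U"
      by (auto simp: Chains_def relation_of_def)
    show "\<exists>u\<in>?A. \<forall>a\<in>C. a \<ge> u"
    proof (cases "C = {}")
      case True
      with assms show ?thesis by auto
    next
      case False
      have "\<exists>W\<in>C. W \<le> inf U V" if "U \<in> C" "V \<in> C" for U V
        using chain[OF that] that by (metis inf.absorb1 inf.absorb2 order_refl)
      \<comment> \<open>A chain is directed, so whatever holds eventually for its infimum already
        does so for one member; hence the infimum is proper.\<close>
      then have "eventually P (Inf C) \<longleftrightarrow> (\<exists>U\<in>C. eventually P U)" for P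
        by (rule eventually_Inf_base[OF False])
      then have "Inf C \<noteq> bot"
        using sub by (auto simp: trivial_limit_def)
      moreover have "Inf C \<le> F"
        using False sub by (auto intro: Inf_lower2)
      ultimately show ?thesis by (auto intro: Inf_lower)
    qed
  qed
  then obtain U where U: "U \<le> F" "U \<noteq> bot"
    and max: "\<And>V. V \<in> ?A \<Longrightarrow> V \<le> U \<Longrightarrow> V = U"
    by blast
  have min: "V = U" if "V \<le> U" "V \<noteq> bot" for V
    using max[of V] that U(1) by simp
  have "eventually P U" if "\<not> eventually (\<lambda>x. \<not> P x) U" for P
  proof -
    have "inf U (principal {x. P x}) \<noteq> bot"
      using that by (auto simp: trivial_limit_def eventually_inf_principal)
    then have "inf U (principal {x. P x}) = U"
      by (intro min) auto
    moreover have "eventually P (inf U (principal {x. P x}))"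
      by (simp add: eventually_inf_principal)
    ultimately show ?thesis by simp
  qed
  with U show ?thesis by (intro that) (auto simp: ultrafilter_def)
qed

lemma ultrafilter_filtermap: "ultrafilter F \<Longrightarrow> ultrafilter (filtermap f F)"
  by (auto simp: ultrafilter_def eventually_filtermap filtermap_bot_iff)

lemma ultrafilter_finite_Union:
  assumes F: "ultrafilter F" and "finite \<C>" and "eventually (\<lambda>x. x \<in> \<Union>\<C>) F"
  obtains C where "C \<in> \<C>" "eventually (\<lambda>x. x \<in> C) F"
proof -
  have False if "\<And>C. C \<in> \<C> \<Longrightarrow> \<not> eventually (\<lambda>x. x \<in> C) F"
  proof -
    have "\<forall>C\<in>\<C>. eventually (\<lambda>x. x \<notin> C) F"
      using that ultrafilter_exhaust[OF F] by blast
    then have "eventually (\<lambda>x. \<forall>C\<in>\<C>. x \<notin> C) F"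
      using \<open>finite \<C>\<close> by (simp add: eventually_ball_finite)
    with assms(3) have "eventually (\<lambda>x. False) F"
      by eventually_elim auto
    then show False using F by (simp add: ultrafilter_def trivial_limit_def)
  qed
  then show ?thesis using that by blast
qed

text \<open>If no point of \<open>K\<close> were a limit, each would have an open neighbourhood that
  \<open>f\<close> eventually avoids, and a finite subcover would make \<open>f\<close> avoid all of
  \<open>K\<close>.\<close>

lemma ultrafilter_limit_compactin:
  assumes F: "ultrafilter F" and K: "compactin X K" and ev: "eventually (\<lambda>x. f x \<in> K) F"
  obtains l where "l \<in> K" "limitin X f l F"
proof -
  have False if no: "\<And>l. l \<in> K \<Longrightarrow> \<not> limitin X f l F"
  proof -
    let ?U = "{U. openin X U \<and> eventually (\<lambda>x. f x \<notin> U) F}"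
    have "K \<subseteq> \<Union>?U"
    proof
      fix l assume "l \<in> K"
      then have "l \<in> topspace X" "\<not> limitin X f l F"
        using no compactin_subset_topspace[OF K] by auto
      then obtain U where "openin X U" "l \<in> U" "\<not> eventually (\<lambda>x. f x \<in> U) F"
        unfolding limitin_def by auto
      then show "l \<in> \<Union>?U" using ultrafilter_exhaust[OF F] by blast
    qed
    then obtain \<C> where \<C>: "finite \<C>" "\<C> \<subseteq> ?U" "K \<subseteq> \<Union>\<C>"
      using compactinD[OF K, of ?U] by blast
    have "eventually (\<lambda>x. \<forall>C\<in>\<C>. f x \<notin> C) F"
      using \<C> by (auto simp: eventually_ball_finite_distrib)
    with ev have "eventually (\<lambda>x. False) F"
      by eventually_elim (use \<C> in auto)
    then show False using F by (simp add: ultrafilter_def trivial_limit_def)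
  qed
  then show ?thesis using that by blast
qed

text \<open>A cover without finite subcover makes the sets \<open>K - \<Union>\<F>\<close> generate
  a proper filter. A finer ultrafilter avoids every member of the cover, so its limit could lie in
  none of them.\<close>

lemma compactin_ultrafilterI:
  assumes "K \<subseteq> topspace X"
    and lim: "\<And>F. ultrafilter F \<Longrightarrow> eventually (\<lambda>x. x \<in> K) F \<Longrightarrow> \<exists>l\<in>K. limitin X (\<lambda>x. x) l F"
  shows "compactin X K"
  unfolding compactin_def
proof (intro conjI allI impI)
  fix \<U> assume \<U>: "(\<forall>U\<in>\<U>. openin X U) \<and> K \<subseteq> \<Union>\<U>"
  show "\<exists>\<F>. finite \<F> \<and> \<F> \<subseteq> \<U> \<and> K \<subseteq> \<Union>\<F>"
  proof (rule ccontr)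
    assume none: "\<nexists>\<F>. finite \<F> \<and> \<F> \<subseteq> \<U> \<and> K \<subseteq> \<Union>\<F>"
    let ?I = "{\<F>. finite \<F> \<and> \<F> \<subseteq> \<U>}"
    let ?F = "INF \<F>\<in>?I. principal (K - \<Union>\<F>)"
    have ev: "eventually P ?F \<longleftrightarrow> (\<exists>\<F>\<in>?I. \<forall>x\<in>K - \<Union>\<F>. P x)" for P
    proof (subst eventually_INF_base)
      fix a b assume "a \<in> ?I" "b \<in> ?I"
      then show "\<exists>x\<in>?I. principal (K - \<Union>x) \<le> inf (principal (K - \<Union>a)) (principal (K - \<Union>b))"
        by (intro bexI[of _ "a \<union> b"]) auto
    qed (auto simp: eventually_principal)
    have "?F \<noteq> bot" unfolding trivial_limit_def ev using none by blast
    then obtain F where F: "F \<le> ?F" "ultrafilter F" by (rule ultrafilter_exists)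
    have evF: "eventually P F" if "\<F> \<in> ?I" "\<forall>x\<in>K - \<Union>\<F>. P x" for P \<F>
      using F(1) ev that by (meson filter_leD)
    obtain l where l: "l \<in> K" "limitin X (\<lambda>x. x) l F"
      using lim[OF F(2)] evF[of "{}" "\<lambda>x. x \<in> K"] by auto
    then obtain U where U: "U \<in> \<U>" "l \<in> U" using \<U> by blast
    then have "eventually (\<lambda>x. x \<in> U) F" using l \<U> by (auto simp: limitin_def)
    moreover have "eventually (\<lambda>x. x \<notin> U) F" by (rule evF[of "{U}"]) (use U in auto)
    ultimately have "eventually (\<lambda>x. False) F" by eventually_elim simp
    then show False using F by (simp add: ultrafilter_def trivial_limit_def)
  qed
qed (fact assms(1))

section \<open>Limits under closures and embeddings\<close>

lemma limitin_closure_of: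
  assumes "F \<noteq> bot" "limitin X f l F" "eventually (\<lambda>x. f x \<in> S) F"
  shows "l \<in> X closure_of S"
  unfolding in_closure_of
proof (intro conjI allI impI)
  show "l \<in> topspace X" using assms(2) by (simp add: limitin_def)
  fix U assume "l \<in> U \<and> openin X U"
  then have "eventually (\<lambda>x. f x \<in> U) F" using assms(2) by (simp add: limitin_def)
  with assms(3) have "eventually (\<lambda>x. f x \<in> S \<and> f x \<in> U) F" by (rule eventually_conj)
  then show "\<exists>y. y \<in> S \<and> y \<in> U" using assms(1) eventually_happens by blast
qed

lemma limitin_filtermap: "limitin X f l (filtermap g F) \<longleftrightarrow> limitin X (\<lambda>x. f (g x)) l F"
  by (simp add: limitin_def eventually_filtermap)

lemma embedding_map_openE:
  assumes e: "embedding_map X Y e" and U: "openin X U"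
  obtains V where "openin Y V" "\<And>x. x \<in> topspace X \<Longrightarrow> e x \<in> V \<longleftrightarrow> x \<in> U"
proof -
  have inj: "inj_on e (topspace X)"
    using e by (auto simp: embedding_map_def homeomorphic_imp_injective_map)
  have "openin (subtopology Y (e ` topspace X)) (e ` U)"
    using e U by (meson embedding_map_def homeomorphic_imp_open_map open_map_def)
  then obtain V where V: "openin Y V" "e ` U = V \<inter> e ` topspace X"
    by (auto simp: openin_subtopology)
  show ?thesis
  proof (rule that[OF V(1)])
    fix x assume x: "x \<in> topspace X"
    then have "e x \<in> V \<longleftrightarrow> e x \<in> e ` U" using V(2) by auto
    then show "e x \<in> V \<longleftrightarrow> x \<in> U"
      using inj_on_image_mem_iff[OF inj x openin_subset[OF U]] by simp
  qed
qed

lemma limitin_embedding_map: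
  assumes e: "embedding_map X Y e" and l: "l \<in> topspace X"
    and lim: "limitin Y e (e l) F" and ev: "eventually (\<lambda>x. x \<in> topspace X) F"
  shows "limitin X (\<lambda>x. x) l F"
  unfolding limitin_def
proof (intro conjI allI impI)
  fix U assume U: "openin X U \<and> l \<in> U"
  then obtain V where V: "openin Y V" "\<And>x. x \<in> topspace X \<Longrightarrow> e x \<in> V \<longleftrightarrow> x \<in> U"
    using embedding_map_openE[OF e] by metis
  then have "eventually (\<lambda>x. e x \<in> V) F"
    using lim l U by (auto simp: limitin_def)
  with ev show "eventually (\<lambda>x. x \<in> U) F"
    by eventually_elim (use V(2) in blast)
qed (fact l)

lemma regular_space_shrink:
  assumes "regular_space X" "openin X U" "x \<in> U"
  obtains V where "openin X V" "x \<in> V" "X closure_of V \<subseteq> U"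
proof -
  have "closedin X (topspace X - U)" "x \<in> topspace X - (topspace X - U)"
    using assms openin_subset by fastforce+
  then obtain V where "openin X V" "x \<in> V" "disjnt (topspace X - U) (X closure_of V)"
    using assms(1) unfolding regular_space by meson
  then show ?thesis
    using that closure_of_subset_topspace[of X V] unfolding disjnt_iff by blast
qed

section \<open>Complete sieves\<close>

text \<open>For \<open>N\<close> dense this is an internal form of having a dense Cech-complete subspace.
  It makes no reference to a compactification, and so carries information from the carrier type
  \<open>'b\<close> of one compactification to the carrier type \<open>'c\<close> of another.\<close>

definition complete_sieve :: "'a topology \<Rightarrow> 'a set \<Rightarrow> (nat \<Rightarrow> 'a set set) \<Rightarrow> bool" where
  "complete_sieve X N \<S> \<longleftrightarrow>
     openin X N \<and> N \<noteq> {} \<and> (\<forall>n. \<forall>S\<in>\<S> n. openin X S) \<and>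
     (\<forall>n Q. openin X Q \<and> Q \<subseteq> N \<and> Q \<noteq> {} \<longrightarrow> (\<exists>S\<in>\<S> n. S \<inter> Q \<noteq> {})) \<and>
     (\<forall>F. ultrafilter F \<and> (\<forall>n. \<exists>S\<in>\<S> n. eventually (\<lambda>x. x \<in> S) F) \<longrightarrow>
        (\<exists>l. limitin X (\<lambda>x. x) l F))"

lemma complete_sieve_limit:
  assumes "complete_sieve X N \<S>" "ultrafilter F"
    and "\<And>n. \<exists>S\<in>\<S> n. eventually (\<lambda>x. x \<in> S) F"
  obtains l where "limitin X (\<lambda>x. x) l F"
  using assms unfolding complete_sieve_def by blast

text \<open>Closures are nested so that the intersection catches the limits of all ultrafilters
  containing every \<open>W n\<close>. It may be more than a point, since members of a sieve need
  not be small.\<close>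

definition shrinking :: "'a topology \<Rightarrow> (nat \<Rightarrow> 'a set set) \<Rightarrow> (nat \<Rightarrow> 'a set) \<Rightarrow> bool" where
  "shrinking X \<S> W \<longleftrightarrow>
     (\<forall>n. openin X (W n) \<and> W n \<noteq> {} \<and> X closure_of W (Suc n) \<subseteq> W n \<and> (\<exists>S\<in>\<S> n. W n \<subseteq> S))"

lemma shrinking_antimono:
  assumes "shrinking X \<S> W" "m \<le> n"
  shows "W n \<subseteq> W m"
proof -
  have "W (Suc k) \<subseteq> W k" for k
  proof -
    have "W (Suc k) \<subseteq> X closure_of W (Suc k)"
      using assms(1) unfolding shrinking_def by (intro closure_of_subset openin_subset) blast
    then show ?thesis using assms(1) unfolding shrinking_def by blast
  qed
  then show ?thesis using assms(2) by (rule lift_Suc_antimono_le)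
qed

lemma shrinking_limit:
  assumes \<S>: "complete_sieve X N \<S>" and W: "shrinking X \<S> W"
    and F: "ultrafilter F" and ev: "\<And>n. eventually (\<lambda>x. x \<in> W n) F"
  obtains l where "l \<in> (\<Inter>n. W n)" "limitin X (\<lambda>x. x) l F"
proof -
  have "\<exists>S\<in>\<S> n. eventually (\<lambda>x. x \<in> S) F" for n
  proof -
    obtain S where "S \<in> \<S> n" "W n \<subseteq> S" using W unfolding shrinking_def by blast
    then show ?thesis by (intro bexI[of _ S] eventually_mono[OF ev[of n]]) auto
  qed
  then obtain l where l: "limitin X (\<lambda>x. x) l F"
    by (rule complete_sieve_limit[OF \<S> F])
  have "l \<in> W n" for n
  proof -
    have "l \<in> X closure_of W (Suc n)"
      using ultrafilter_nonbot[OF F] l ev by (rule limitin_closure_of)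
    then show ?thesis using W by (auto simp: shrinking_def)
  qed
  with l show ?thesis by (intro that) auto
qed

text \<open>Any ultrafilter finer than \<open>sequentially\<close> works, as the tails of
  \<open>a\<close> lie in each \<open>W n\<close>. In particular the intersection is nonempty, which
  is how \<open>complete_sieve_Baire\<close> finds its point.\<close>

lemma shrinking_sequence_limit:
  assumes \<S>: "complete_sieve X N \<S>" and W: "shrinking X \<S> W" and a: "\<And>n. a n \<in> W n"
  obtains F l where "ultrafilter F" "l \<in> (\<Inter>n. W n)" "limitin X a l F"
proof -
  obtain F where F: "F \<le> sequentially" "ultrafilter F"
    by (rule ultrafilter_exists[of "sequentially"]) auto
  have "eventually (\<lambda>k. a k \<in> W n) sequentially" for n
    unfolding eventually_sequentially using a shrinking_antimono[OF W] by blast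
  then have "eventually (\<lambda>x. x \<in> W n) (filtermap a F)" for n
    using F(1) by (auto simp: eventually_filtermap intro: filter_leD)
  then obtain l where "l \<in> (\<Inter>n. W n)" "limitin X (\<lambda>x. x) l (filtermap a F)"
    using shrinking_limit[OF \<S> W ultrafilter_filtermap[OF F(2)]] by blast
  then show ?thesis using F(2) by (intro that) (auto simp: limitin_filtermap)
qed

text \<open>Otherwise points of the \<open>W n\<close> outside \<open>V\<close> would have an
  ultrafilter limit in the intersection and thus in \<open>V\<close>.\<close>

lemma shrinking_base:
  assumes \<S>: "complete_sieve X N \<S>" and W: "shrinking X \<S> W"
    and V: "openin X V" "(\<Inter>n. W n) \<subseteq> V"
  obtains n where "W n \<subseteq> V"
proof -
  have False if "\<And>n. \<not> W n \<subseteq> V"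
  proof -
    from that have "\<forall>n. \<exists>x. x \<in> W n \<and> x \<notin> V" by blast
    then obtain a where a: "\<And>n. a n \<in> W n" "\<And>n. a n \<notin> V" by metis
    obtain F l where F: "ultrafilter F" "l \<in> (\<Inter>n. W n)" "limitin X a l F"
      using shrinking_sequence_limit[OF \<S> W a(1)] by blast
    then have "eventually (\<lambda>n. a n \<in> V) F" using V by (auto simp: limitin_def)
    then show False using a(2) F(1) by (simp add: ultrafilter_def trivial_limit_def)
  qed
  then show ?thesis using that by blast
qed

text \<open>These are the compact sets to which \<open>k\<close>-gentleness is applied. An
  ultrafilter on such a set either contains every \<open>W n\<close> and converges into the
  intersection, or excludes some \<open>W n\<close> and is concentrated on one of the finitely many
  earlier terms.\<close>

lemma compactin_shrinking_sequence:
  assumes \<S>: "complete_sieve X N \<S>" and W: "shrinking X \<S> W" and a: "\<And>n. a n \<in> W n"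
  shows "compactin X ((\<Inter>n. W n) \<union> range a)"
proof (rule compactin_ultrafilterI)
  have sub: "W n \<subseteq> topspace X" for n using W by (auto simp: shrinking_def openin_subset)
  then show "(\<Inter>n. W n) \<union> range a \<subseteq> topspace X" using a by blast
  fix F assume F: "ultrafilter F" and ev: "eventually (\<lambda>x. x \<in> (\<Inter>n. W n) \<union> range a) F"
  show "\<exists>l\<in>(\<Inter>n. W n) \<union> range a. limitin X (\<lambda>x. x) l F"
  proof (cases "\<forall>n. eventually (\<lambda>x. x \<in> W n) F")
    case True
    then show ?thesis using shrinking_limit[OF \<S> W F] by blast
  next
    case False
    then obtain n where "\<not> eventually (\<lambda>x. x \<in> W n) F" by blast
    then have "eventually (\<lambda>x. x \<notin> W n) F" using ultrafilter_exhaust[OF F] by blast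
    with ev have "eventually (\<lambda>x. x \<in> \<Union>((\<lambda>k. {a k}) ` {..<n})) F"
    proof eventually_elim
      case (elim x)
      then obtain k where "x = a k" by blast
      moreover have "k < n"
        using elim(2) a[of k] shrinking_antimono[OF W, of n k] \<open>x = a k\<close> by force
      ultimately show ?case by auto
    qed
    then obtain k where "eventually (\<lambda>x. x = a k) F"
      by (rule ultrafilter_finite_Union[OF F, rotated]) auto
    then have "limitin X (\<lambda>x. x) (a k) F"
      using sub[of k] a[of k] by (intro limitin_eventually) auto
    then show ?thesis by blast
  qed
qed

lemma compactin_shrinking:
  assumes "complete_sieve X N \<S>" "shrinking X \<S> W" "p \<in> (\<Inter>n. W n)"
  shows "compactin X (\<Inter>n. W n)"
proof -
  have "(\<Inter>n. W n) \<union> range (\<lambda>_::nat. p) = (\<Inter>n. W n)" using assms(3) by auto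
  then show ?thesis
    using compactin_shrinking_sequence[OF assms(1,2), of "\<lambda>_. p"] assms(3) by simp
qed

text \<open>Finitely many \<open>U k\<close> cover the compact intersection, hence some
  \<open>W n\<close>; the image \<open>h\<close> W n\<open>is then covered by finitely many\<close>h
  \<open>U k\<close>, and the ultrafilter selects one. Keeping \<open>h\<close> arbitrary lets left
  and right translations share the argument.\<close>

lemma shrinking_ultrafilter_cover:
  assumes \<S>: "complete_sieve X N \<S>" and W: "shrinking X \<S> W" "p \<in> (\<Inter>n. W n)"
    and F: "ultrafilter F"
    and U: "\<And>k. k \<in> (\<Inter>n. W n) \<Longrightarrow> openin X (U k)" "\<And>k. k \<in> (\<Inter>n. W n) \<Longrightarrow> k \<in> U k"
    and ev: "\<And>n. \<exists>h\<in>H. eventually (\<lambda>x. x \<in> h ` W n) F"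
  obtains h k where "h \<in> H" "k \<in> (\<Inter>n. W n)" "eventually (\<lambda>x. x \<in> h ` U k) F"
proof -
  define K where "K = (\<Inter>n. W n)"
  have K: "compactin X K" using compactin_shrinking[OF \<S> W] by (simp add: K_def)
  have "openin X V" if "V \<in> U ` K" for V using that U(1) by (auto simp: K_def)
  moreover have "K \<subseteq> \<Union>(U ` K)" using U(2) by (auto simp: K_def)
  ultimately obtain \<C> where \<C>: "finite \<C>" "\<C> \<subseteq> U ` K" "K \<subseteq> \<Union>\<C>"
    using compactinD[OF K, of "U ` K"] by metis
  have "openin X (\<Union>\<C>)" using \<C>(2) U(1) by (intro openin_Union) (auto simp: K_def)
  then obtain n where n: "W n \<subseteq> \<Union>\<C>"
    using shrinking_base[OF \<S> W(1)] \<C>(3) unfolding K_def by blast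
  obtain h where h: "h \<in> H" "eventually (\<lambda>x. x \<in> h ` W n) F" using ev by blast
  from h(2) have "eventually (\<lambda>x. x \<in> \<Union>((`) h ` \<C>)) F"
    by eventually_elim (use n in blast)
  then obtain D where "D \<in> (`) h ` \<C>" and D: "eventually (\<lambda>x. x \<in> D) F"
    by (rule ultrafilter_finite_Union[OF F finite_imageI[OF \<C>(1)]])
  then obtain k where "k \<in> K" "D = h ` U k" using \<C>(2) by blast
  with D h(1) show ?thesis by (intro that) (auto simp: K_def)
qed

text \<open>Localises a shrinking sequence at \<open>p\<close>: the new intersection lies both in
  the old one and in \<open>Q\<close>, where \<open>continuous_map_inv\<close> already controls the
  inverse.\<close>

lemma shrinking_refine:
  assumes "regular_space X" and W: "shrinking X \<S> W"
    and p: "p \<in> (\<Inter>n. W n)" and Q: "openin X Q" "p \<in> Q"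
  obtains V where "shrinking X \<S> V" "\<And>n. p \<in> V n" "\<And>n. V n \<subseteq> W n \<inter> Q"
proof -
  have oW: "openin X (W n)" for n using W by (auto simp: shrinking_def)
  have "\<exists>V. \<forall>n. (openin X (V n) \<and> p \<in> V n \<and> V n \<subseteq> W n \<inter> Q) \<and> X closure_of V (Suc n) \<subseteq> V n"
  proof (rule dependent_nat_choice)
    show "\<exists>V. openin X V \<and> p \<in> V \<and> V \<subseteq> W 0 \<inter> Q"
      using oW Q p by (intro exI[of _ "W 0 \<inter> Q"]) auto
    fix U n assume U: "openin X U \<and> p \<in> U \<and> U \<subseteq> W n \<inter> Q"
    have "openin X (U \<inter> W (Suc n))" "p \<in> U \<inter> W (Suc n)" using U oW p by auto
    then obtain V where V: "openin X V" "p \<in> V" "X closure_of V \<subseteq> U \<inter> W (Suc n)"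
      by (rule regular_space_shrink[OF assms(1)])
    then have "V \<subseteq> U \<inter> W (Suc n)" by (meson closure_of_subset openin_subset order_trans)
    with U V show "\<exists>V. (openin X V \<and> p \<in> V \<and> V \<subseteq> W (Suc n) \<inter> Q) \<and> X closure_of V \<subseteq> U"
      by (intro exI[of _ V]) auto
  qed
  then obtain V where V: "\<And>n. openin X (V n)" "\<And>n. p \<in> V n" "\<And>n. V n \<subseteq> W n \<inter> Q"
    "\<And>n. X closure_of V (Suc n) \<subseteq> V n" by blast
  have "\<exists>S\<in>\<S> n. V n \<subseteq> S" for n
  proof -
    obtain S where "S \<in> \<S> n" "W n \<subseteq> S" using W unfolding shrinking_def by blast
    then show ?thesis using V(3)[of n] by blast
  qed
  with V have "shrinking X \<S> V" unfolding shrinking_def by blast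
  with V show ?thesis by (intro that)
qed

text \<open>The Baire category argument for complete sieves. Each \<open>W n\<close> is chosen
  inside \<open>R n\<close> and a member of level \<open>n\<close>, with closure in its predecessor;
  completeness of the sieve then replaces compactness.\<close>

lemma complete_sieve_Baire:
  assumes X: "regular_space X" and \<S>: "complete_sieve X N \<S>"
    and N0: "openin X N0" "N0 \<noteq> {}" "N0 \<subseteq> N"
    and R: "\<And>n. openin X (R n)"
    and dense: "\<And>n Q. openin X Q \<Longrightarrow> Q \<noteq> {} \<Longrightarrow> Q \<subseteq> N0 \<Longrightarrow> Q \<inter> R n \<noteq> {}"
  obtains W p where "shrinking X \<S> W" "\<And>n. W n \<subseteq> N0 \<inter> R n" "p \<in> (\<Inter>n. W n)"
proof -
  have step: "\<exists>V. (openin X V \<and> V \<noteq> {} \<and> V \<subseteq> N0 \<inter> R n \<and> (\<exists>S\<in>\<S> n. V \<subseteq> S)) \<and> X closure_of V \<subseteq> Q"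
    if Q: "openin X Q" "Q \<noteq> {}" "Q \<subseteq> N0" for Q n
  proof -
    have "openin X (Q \<inter> R n)" "Q \<inter> R n \<noteq> {}" "Q \<inter> R n \<subseteq> N" 
      using dense[OF Q] Q R N0 by auto
    then obtain S where S: "S \<in> \<S> n" "S \<inter> (Q \<inter> R n) \<noteq> {}"
      using \<S> unfolding complete_sieve_def by meson
    then obtain x where x: "x \<in> S \<inter> (Q \<inter> R n)" by blast
    have "openin X S" using S(1) \<S> unfolding complete_sieve_def by blast
    then have "openin X (S \<inter> (Q \<inter> R n))" using Q R by auto
    then obtain V where V: "openin X V" "x \<in> V" "X closure_of V \<subseteq> S \<inter> (Q \<inter> R n)"
      using x by (rule regular_space_shrink[OF X])
    then have "V \<subseteq> S \<inter> (Q \<inter> R n)" by (meson closure_of_subset openin_subset order_trans)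
    with V S Q show ?thesis by (intro exI[of _ V]) auto
  qed
  have "\<exists>V. \<forall>n. (openin X (V n) \<and> V n \<noteq> {} \<and> V n \<subseteq> N0 \<inter> R n \<and> (\<exists>S\<in>\<S> n. V n \<subseteq> S)) \<and>
      X closure_of V (Suc n) \<subseteq> V n"
  proof (rule dependent_nat_choice)
    show "\<exists>V. openin X V \<and> V \<noteq> {} \<and> V \<subseteq> N0 \<inter> R 0 \<and> (\<exists>S\<in>\<S> 0. V \<subseteq> S)"
      using step[OF N0(1,2) order_refl, of 0] by blast
    show "\<exists>V. (openin X V \<and> V \<noteq> {} \<and> V \<subseteq> N0 \<inter> R (Suc n) \<and> (\<exists>S\<in>\<S> (Suc n). V \<subseteq> S)) \<and>
        X closure_of V \<subseteq> U"
      if "openin X U \<and> U \<noteq> {} \<and> U \<subseteq> N0 \<inter> R n \<and> (\<exists>S\<in>\<S> n. U \<subseteq> S)" for U n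
      using that by (intro step) auto
  qed
  then obtain W where W: "shrinking X \<S> W" "\<And>n. W n \<subseteq> N0 \<inter> R n"
    unfolding shrinking_def by blast
  then have "\<forall>n. \<exists>x. x \<in> W n" by (auto simp: shrinking_def)
  then obtain a where "\<And>n. a n \<in> W n" by metis
  then obtain F p where "p \<in> (\<Inter>n. W n)"
    using shrinking_sequence_limit[OF \<S> W(1)] by blast
  with W show ?thesis by (intro that)
qed

lemma complete_sieve_shrinking:
  assumes "regular_space X" and \<S>: "complete_sieve X N \<S>"
  obtains W p where "shrinking X \<S> W" "p \<in> (\<Inter>n. W n)"
proof -
  have "openin X N" "N \<noteq> {}" using \<S> unfolding complete_sieve_def by auto
  then show ?thesis
    using complete_sieve_Baire[OF assms _ _ order_refl, of "\<lambda>_. topspace X"] that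
    by (metis inf.absorb1 openin_subset openin_topspace)
qed

section \<open>Continuity of the inversion in \<open>k\<close>-gentle paratopological groups\<close>

context paratopological_group
begin

section \<open>Translations and homogeneity\<close>

lemma mult_inv_cancel:
  assumes "x \<in> carrier G" "y \<in> carrier G"
  shows "x \<otimes> (inv x \<otimes> y) = y" "inv x \<otimes> (x \<otimes> y) = y"
  using assms by (simp_all add: m_assoc[symmetric])

lemma openin_carrier: "openin T U \<Longrightarrow> x \<in> U \<Longrightarrow> x \<in> carrier G"
  using openin_subset topspace_eq_carrier by blast

lemma limitin_carrier: "limitin T f l F \<Longrightarrow> l \<in> carrier G"
  using limitin_topspace topspace_eq_carrier by metis

lemma limitin_mult:
  assumes "limitin T f a F" "limitin T g b F"
  shows "limitin T (\<lambda>x. f x \<otimes> g x) (a \<otimes> b) F"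
proof -
  have "limitin (prod_topology T T) (\<lambda>x. (f x, g x)) (a, b) F"
    using assms by (simp add: limitin_pairwise o_def)
  from continuous_map_limit[OF continuous_mult this] show ?thesis by (simp add: o_def)
qed

lemma continuous_map_mult:
  assumes "continuous_map X T f" "continuous_map X T g"
  shows "continuous_map X T (\<lambda>x. f x \<otimes> g x)"
proof -
  have "continuous_map X (prod_topology T T) (\<lambda>x. (f x, g x))"
    using assms by (simp add: continuous_map_pairwise o_def)
  from continuous_map_compose[OF this continuous_mult] show ?thesis by (simp add: o_def)
qed

lemma continuous_map_left_translation: "g \<in> carrier G \<Longrightarrow> continuous_map T T (\<lambda>x. g \<otimes> x)"
  by (intro continuous_map_mult) (auto simp: topspace_eq_carrier)

lemma continuous_map_right_translation: "g \<in> carrier G \<Longrightarrow> continuous_map T T (\<lambda>x. x \<otimes> g)"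
  by (intro continuous_map_mult) (auto simp: topspace_eq_carrier)

lemma openin_left_translation:
  assumes "g \<in> carrier G" "openin T V"
  shows "openin T ((\<lambda>x. g \<otimes> x) ` V)"
proof -
  have "(\<lambda>x. g \<otimes> x) ` V = {x \<in> topspace T. inv g \<otimes> x \<in> V}"
  proof (intro equalityI subsetI)
    fix x assume "x \<in> {x \<in> topspace T. inv g \<otimes> x \<in> V}"
    then show "x \<in> (\<lambda>x. g \<otimes> x) ` V"
      using assms by (intro image_eqI[of _ _ "inv g \<otimes> x"]) (auto simp: topspace_eq_carrier m_assoc[symmetric])
  qed (use assms in \<open>auto simp: topspace_eq_carrier m_assoc[symmetric] openin_carrier\<close>)
  then show ?thesis
    using assms by (simp add: openin_continuous_map_preimage[OF continuous_map_left_translation])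
qed

lemma openin_right_translation:
  assumes "g \<in> carrier G" "openin T V"
  shows "openin T ((\<lambda>x. x \<otimes> g) ` V)"
proof -
  have "(\<lambda>x. x \<otimes> g) ` V = {x \<in> topspace T. x \<otimes> inv g \<in> V}"
  proof (intro equalityI subsetI)
    fix x assume "x \<in> {x \<in> topspace T. x \<otimes> inv g \<in> V}"
    then show "x \<in> (\<lambda>x. x \<otimes> g) ` V"
      using assms by (intro image_eqI[of _ _ "x \<otimes> inv g"]) (auto simp: topspace_eq_carrier m_assoc)
  qed (use assms in \<open>auto simp: topspace_eq_carrier m_assoc openin_carrier\<close>)
  then show ?thesis
    using assms by (simp add: openin_continuous_map_preimage[OF continuous_map_right_translation])
qed

lemma mult_neighbourhoods:
  assumes "openin T U" "x \<in> carrier G" "y \<in> carrier G" "x \<otimes> y \<in> U"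
  obtains A B where "openin T A" "openin T B" "x \<in> A" "y \<in> B"
    "\<And>a b. a \<in> A \<Longrightarrow> b \<in> B \<Longrightarrow> a \<otimes> b \<in> U"
proof -
  let ?P = "{z \<in> topspace (prod_topology T T). (\<lambda>(x, y). x \<otimes> y) z \<in> U}"
  have "openin (prod_topology T T) ?P"
    using continuous_mult assms(1) by (rule openin_continuous_map_preimage)
  moreover have "(x, y) \<in> ?P" using assms by (auto simp: topspace_eq_carrier)
  ultimately obtain A B where "openin T A" "openin T B" "x \<in> A" "y \<in> B" "A \<times> B \<subseteq> ?P"
    unfolding openin_prod_topology_alt by meson
  then show ?thesis by (intro that) auto
qed

text \<open>By homogeneity: the left translation by \<open>x \<otimes> inv u\<close> carries
  \<open>u\<close> to \<open>x\<close>, and a compact neighbourhood along with it.\<close>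

lemma locally_compact_space_if_compact_neighbourhood:
  assumes "openin T U" "U \<noteq> {}" "compactin T K" "U \<subseteq> K"
  shows "locally_compact_space T"
  unfolding locally_compact_space_def
proof
  fix x assume "x \<in> topspace T"
  then have x: "x \<in> carrier G" by (simp add: topspace_eq_carrier)
  obtain u where u: "u \<in> U" using assms by blast
  then have uc: "u \<in> carrier G" using assms openin_carrier by blast
  let ?f = "\<lambda>y. (x \<otimes> inv u) \<otimes> y"
  have "openin T (?f ` U)" using assms x uc by (intro openin_left_translation) auto
  moreover have "compactin T (?f ` K)"
    using assms(3) by (rule image_compactin) (use x uc in \<open>auto intro: continuous_map_left_translation\<close>)
  moreover have "x \<in> ?f ` U"
    using u x uc by (intro image_eqI[of _ _ u]) (auto simp: m_assoc)
  ultimately show "\<exists>U K. openin T U \<and> compactin T K \<and> x \<in> U \<and> U \<subseteq> K"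
    using assms(4) by blast
qed

end

context k_gentle_paratopological_group
begin

text \<open>On a compact set the graph of the inversion is the closed set \<open>x \<otimes> y = \<one>\<close>
  inside a compact square.\<close>

lemma limitin_inv_compactin:
  assumes H: "Hausdorff_space T" and K: "compactin T K" and F: "ultrafilter F"
    and ev: "eventually (\<lambda>x. f x \<in> K) F" and lim: "limitin T f l F"
  shows "limitin T (\<lambda>x. inv (f x)) (inv l) F"
proof -
  have "compactin T ((\<lambda>x. inv x) ` K)"
    using k_gentle_inv K by (auto simp: k_gentle_map_def)
  moreover have "eventually (\<lambda>x. inv (f x) \<in> (\<lambda>x. inv x) ` K) F"
    using ev by eventually_elim auto
  ultimately obtain r where "r \<in> (\<lambda>x. inv x) ` K" and r: "limitin T (\<lambda>x. inv (f x)) r F"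
    by (rule ultrafilter_limit_compactin[OF F])
  have "limitin T (\<lambda>x. f x \<otimes> inv (f x)) (l \<otimes> r) F"
    using lim r by (rule limitin_mult)
  moreover have "limitin T (\<lambda>x. f x \<otimes> inv (f x)) \<one> F"
  proof (rule limitin_eventually)
    show "eventually (\<lambda>x. f x \<otimes> inv (f x) = \<one>) F"
      using ev by eventually_elim
        (use K compactin_subset_topspace topspace_eq_carrier in fastforce)
  qed (simp add: topspace_eq_carrier)
  ultimately have "l \<otimes> r = \<one>"
    using limitin_Hausdorff_unique[OF _ _ ultrafilter_nonbot[OF F] H] by blast
  then have "r = inv l"
    using limitin_carrier[OF lim] limitin_carrier[OF r] by (metis inv_comm inv_equality)
  with r show ?thesis by simp
qed

text \<open>Continuity is proved at one point \<open>p\<close>, in two stages: first for the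
  restriction to the compact set \<open>K\<close>, then, along sequences converging to
  \<open>K\<close>, on a whole neighbourhood. Translations spread it over the group.\<close>

lemma continuous_map_inv:
  assumes H: "Hausdorff_space T" and reg: "regular_space T" and \<S>: "complete_sieve T N \<S>"
  shows "continuous_map T T (\<lambda>x. inv x)"
proof -
  obtain W p where W: "shrinking T \<S> W" and p: "p \<in> (\<Inter>n. W n)"
    by (rule complete_sieve_shrinking[OF reg \<S>])
  have oW: "openin T (W n)" for n using W by (auto simp: shrinking_def)
  have pc: "p \<in> carrier G" using p oW openin_carrier by blast
  define K where "K = (\<Inter>n. W n)"
  have K: "compactin T K" using compactin_shrinking[OF \<S> W p] by (simp add: K_def)
  have at_p: "\<exists>Q. openin T Q \<and> p \<in> Q \<and> (\<forall>x\<in>Q. inv x \<in> V)" if V: "openin T V" "inv p \<in> V" for V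
  proof -
    have "\<exists>Q. openin T Q \<and> p \<in> Q \<and> (\<forall>x\<in>Q \<inter> K. inv x \<in> V)"
    proof (rule ccontr)
      assume no: "\<nexists>Q. openin T Q \<and> p \<in> Q \<and> (\<forall>x\<in>Q \<inter> K. inv x \<in> V)"
      \<comment> \<open>Neighbourhoods of \<open>p\<close> traced on the points of \<open>K\<close>
        violating the claim. An ultrafilter below this filter converges to \<open>p\<close> inside
        \<open>K\<close>, so its inverses must converge to \<open>inv p\<close>.\<close>
      let ?F = "inf (nhdsin T p) (principal {x \<in> K. inv x \<notin> V})"
      have "?F \<noteq> bot"
        unfolding trivial_limit_def eventually_inf_principal eventually_nhdsin
        using no pc topspace_eq_carrier by (simp, blast)
      then obtain F where F: "F \<le> ?F" "ultrafilter F" by (rule ultrafilter_exists)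
      have "eventually (\<lambda>x. x \<in> {x \<in> K. inv x \<notin> V}) ?F"
        by (simp add: eventually_inf_principal)
      then have ev: "eventually (\<lambda>x. x \<in> {x \<in> K. inv x \<notin> V}) F"
        using F(1) filter_leD by blast
      have "limitin T (\<lambda>x. x) p F"
        unfolding limitin_def
      proof (intro conjI allI impI)
        show "p \<in> topspace T" using pc topspace_eq_carrier by simp
        fix U assume "openin T U \<and> p \<in> U"
        then have "eventually (\<lambda>x. x \<in> U) ?F"
          by (auto simp: eventually_inf_principal eventually_nhdsin)
        then show "eventually (\<lambda>x. x \<in> U) F" using F(1) filter_leD by blast
      qed
      then have "limitin T (\<lambda>x. inv x) (inv p) F"
        using ev by (intro limitin_inv_compactin[OF H K F(2)]) (auto elim: eventually_mono)
      then have "eventually (\<lambda>x. inv x \<in> V) F" using V by (auto simp: limitin_def)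
      with ev have "eventually (\<lambda>x. False) F" by eventually_elim simp
      then show False using F(2) by (simp add: ultrafilter_def trivial_limit_def)
    qed
    then obtain Q where Q: "openin T Q" "p \<in> Q" "\<And>x. x \<in> Q \<inter> K \<Longrightarrow> inv x \<in> V" by blast
    obtain W' where W': "shrinking T \<S> W'" "\<And>n. p \<in> W' n" "\<And>n. W' n \<subseteq> W n \<inter> Q"
      using shrinking_refine[OF reg W p Q(1,2)] by blast
    \<comment> \<open>Bad points \<open>a n\<close> together with the intersection of the
      \<open>W' n\<close> would form a compact set, so inversion respects their limit
      \<open>q\<close>. But \<open>q\<close> lies in \<open>Q \<inter> K\<close>, hence
      \<open>inv q\<close> lies in \<open>V\<close>.\<close>
    have "\<exists>n. \<forall>x\<in>W' n. inv x \<in> V"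
    proof (rule ccontr)
      assume "\<nexists>n. \<forall>x\<in>W' n. inv x \<in> V"
      then obtain a where a: "\<And>n. a n \<in> W' n" "\<And>n. inv (a n) \<notin> V" by metis
      obtain F q where F: "ultrafilter F" and q: "q \<in> (\<Inter>n. W' n)" "limitin T a q F"
        using shrinking_sequence_limit[OF \<S> W'(1) a(1)] by blast
      have "limitin T (\<lambda>n. inv (a n)) (inv q) F"
        using compactin_shrinking_sequence[OF \<S> W'(1) a(1)] q(2)
        by (intro limitin_inv_compactin[OF H _ F]) auto
      moreover have "inv q \<in> V" using q(1) W'(3) unfolding K_def by (intro Q(3)) (unfold K_def, blast)
      ultimately have "eventually (\<lambda>n. inv (a n) \<in> V) F" using V by (auto simp: limitin_def)
      then show False using a(2) F by (simp add: ultrafilter_def trivial_limit_def)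
    qed
    then show ?thesis using W' by (meson shrinking_def)
  qed
  show ?thesis
    unfolding continuous_map_def
  proof (intro conjI allI impI)
    show "(\<lambda>x. inv x) \<in> topspace T \<rightarrow> topspace T" by (auto simp: topspace_eq_carrier)
    fix U assume U: "openin T U"
    show "openin T {x \<in> topspace T. inv x \<in> U}"
    proof (subst openin_subopen, intro ballI)
      fix x assume "x \<in> {x \<in> topspace T. inv x \<in> U}"
      then have x: "x \<in> carrier G" "inv x \<in> U" by (auto simp: topspace_eq_carrier)
      \<comment> \<open>Right translation by \<open>?c\<close> carries \<open>p\<close> to
        \<open>x\<close>, and \<open>inv (y \<otimes> ?c) = inv ?c \<otimes> inv y\<close>. Thus the
        claim at \<open>x\<close> for \<open>U\<close> is the claim at \<open>p\<close> for the left
        translate of \<open>U\<close> by \<open>?c\<close>.\<close>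
      let ?c = "inv p \<otimes> x"
      have c: "?c \<in> carrier G" using x pc by simp
      have "openin T ((\<lambda>y. ?c \<otimes> y) ` U)" using c U by (rule openin_left_translation)
      moreover have "inv p \<in> (\<lambda>y. ?c \<otimes> y) ` U"
        using x pc by (intro image_eqI[of _ _ "inv x"]) (auto simp: m_assoc)
      ultimately have "\<exists>Q. openin T Q \<and> p \<in> Q \<and> (\<forall>y\<in>Q. inv y \<in> (\<lambda>y. ?c \<otimes> y) ` U)"
        by (rule at_p)
      then obtain Q where Q: "openin T Q" "p \<in> Q" "\<And>y. y \<in> Q \<Longrightarrow> inv y \<in> (\<lambda>y. ?c \<otimes> y) ` U"
        by metis
      have "openin T ((\<lambda>y. y \<otimes> ?c) ` Q)" using c Q(1) by (rule openin_right_translation)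
      moreover have "x \<in> (\<lambda>y. y \<otimes> ?c) ` Q"
        using x pc Q(2) by (intro image_eqI[of _ _ p]) (auto simp: m_assoc[symmetric])
      moreover have "(\<lambda>y. y \<otimes> ?c) ` Q \<subseteq> {x \<in> topspace T. inv x \<in> U}"
      proof
        fix z assume "z \<in> (\<lambda>y. y \<otimes> ?c) ` Q"
        then obtain y where y: "y \<in> Q" "z = y \<otimes> ?c" by blast
        then obtain u where u: "u \<in> U" "inv y = ?c \<otimes> u" using Q(3) by blast
        have yc: "y \<in> carrier G" and uc: "u \<in> carrier G"
          using y u Q(1) U openin_carrier by blast+
        have "inv z = inv ?c \<otimes> inv y" using y yc c by (simp add: inv_mult_group)
        also have "\<dots> = u" unfolding u(2) using c uc by (simp add: m_assoc[symmetric] del: inv_mult_group)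
        finally show "z \<in> {x \<in> topspace T. inv x \<in> U}"
          using u(1) y yc c by (simp add: topspace_eq_carrier)
      qed
      ultimately show "\<exists>Ta. openin T Ta \<and> x \<in> Ta \<and> Ta \<subseteq> {x \<in> topspace T. inv x \<in> U}" by blast
    qed
  qed
qed

end

section \<open>Cauchy ultrafilters in topological groups\<close>

locale topological_group = paratopological_group +
  assumes continuous_inv: "continuous_map T T (\<lambda>x. inv x)"
begin

lemma quotient_neighbourhood:
  assumes V: "openin T V" "\<one> \<in> V"
  obtains U where "openin T U" "\<one> \<in> U"
    "\<And>a b. a \<in> U \<Longrightarrow> b \<in> U \<Longrightarrow> a \<otimes> inv b \<in> V \<and> inv a \<otimes> b \<in> V"
proof -
  obtain A B where AB: "openin T A" "openin T B" "\<one> \<in> A" "\<one> \<in> B"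
    "\<And>a b. a \<in> A \<Longrightarrow> b \<in> B \<Longrightarrow> a \<otimes> b \<in> V"
    using mult_neighbourhoods[of V \<one> \<one>] V by (metis l_one one_closed)
  \<comment> \<open>A symmetric set inside \<open>A \<inter> B\<close>, so both quotients are
    products of a point of \<open>A\<close> and a point of \<open>B\<close>.\<close>
  let ?U = "{x \<in> topspace T. inv x \<in> A \<inter> B} \<inter> (A \<inter> B)"
  have "openin T ?U"
    using AB by (intro openin_Int openin_continuous_map_preimage[OF continuous_inv]) auto
  then show ?thesis using AB by (intro that[of ?U]) (auto simp: topspace_eq_carrier)
qed

text \<open>Cauchy filters of the two-sided uniformity. The one-sided notion would not do: in
  \<open>cauchy_translate_dense\<close> a left difference and a right difference must both be small.\<close>

definition cauchy :: "'a filter \<Rightarrow> bool" where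
  "cauchy F \<longleftrightarrow> (\<forall>V. openin T V \<and> \<one> \<in> V \<longrightarrow>
     (\<exists>A\<subseteq>carrier G. eventually (\<lambda>x. x \<in> A) F \<and>
        (\<forall>a\<in>A. \<forall>b\<in>A. a \<otimes> inv b \<in> V \<and> inv a \<otimes> b \<in> V)))"

lemma cauchyE:
  assumes "cauchy F" "openin T V" "\<one> \<in> V"
  obtains A where "A \<subseteq> carrier G" "eventually (\<lambda>x. x \<in> A) F"
    "\<And>a b. a \<in> A \<Longrightarrow> b \<in> A \<Longrightarrow> a \<otimes> inv b \<in> V"
    "\<And>a b. a \<in> A \<Longrightarrow> b \<in> A \<Longrightarrow> inv a \<otimes> b \<in> V"
  using assms unfolding cauchy_def by metis

text \<open>The differences \<open>a \<otimes> inv b\<close> do not change, while the differences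
  \<open>inv a \<otimes> b\<close> are conjugated by \<open>c\<close>; \<open>V'\<close> is chosen
  to absorb this conjugation.\<close>

lemma cauchy_right_translation:
  assumes F: "cauchy F" and c: "c \<in> carrier G"
  shows "cauchy (filtermap (\<lambda>x. x \<otimes> c) F)"
  unfolding cauchy_def
proof (intro allI impI)
  fix V assume V: "openin T V \<and> \<one> \<in> V"
  define V' where "V' = V \<inter> {x \<in> topspace T. (inv c \<otimes> x) \<otimes> c \<in> V}"
  have "continuous_map T T (\<lambda>x. (inv c \<otimes> x) \<otimes> c)"
    using c by (intro continuous_map_mult) (auto simp: topspace_eq_carrier)
  then have "openin T V'" using V unfolding V'_def by (intro openin_Int openin_continuous_map_preimage) auto
  moreover have "\<one> \<in> V'" using V c by (simp add: V'_def topspace_eq_carrier)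
  ultimately obtain A where A: "A \<subseteq> carrier G" "eventually (\<lambda>x. x \<in> A) F"
    "\<And>a b. a \<in> A \<Longrightarrow> b \<in> A \<Longrightarrow> a \<otimes> inv b \<in> V'"
    "\<And>a b. a \<in> A \<Longrightarrow> b \<in> A \<Longrightarrow> inv a \<otimes> b \<in> V'"
    using cauchyE[OF F] by metis
  let ?A = "(\<lambda>x. x \<otimes> c) ` A"
  have "(a \<otimes> c) \<otimes> inv (b \<otimes> c) \<in> V \<and> inv (a \<otimes> c) \<otimes> (b \<otimes> c) \<in> V"
    if ab: "a \<in> A" "b \<in> A" for a b
  proof -
    have car: "a \<in> carrier G" "b \<in> carrier G" using ab A(1) by auto
    have "(a \<otimes> c) \<otimes> inv (b \<otimes> c) = a \<otimes> inv b"
      using car c by (simp add: inv_mult_group m_assoc mult_inv_cancel)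
    moreover have "inv (a \<otimes> c) \<otimes> (b \<otimes> c) = (inv c \<otimes> (inv a \<otimes> b)) \<otimes> c"
      using car c by (simp add: inv_mult_group m_assoc)
    ultimately show ?thesis using A(3)[OF ab] A(4)[OF ab] by (auto simp: V'_def)
  qed
  moreover have "eventually (\<lambda>x. x \<in> ?A) (filtermap (\<lambda>x. x \<otimes> c) F)"
    unfolding eventually_filtermap using A(2) by eventually_elim auto
  moreover have "?A \<subseteq> carrier G" using A(1) c by auto
  ultimately show "\<exists>A\<subseteq>carrier G. eventually (\<lambda>x. x \<in> A) (filtermap (\<lambda>x. x \<otimes> c) F) \<and>
      (\<forall>a\<in>A. \<forall>b\<in>A. a \<otimes> inv b \<in> V \<and> inv a \<otimes> b \<in> V)"
    by (intro exI[of _ ?A]) auto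
qed

text \<open>The translate \<open>F x\<close> of a Cauchy ultrafilter by a generic \<open>x\<close> meets every level of the
  sieve.\<close>

lemma cauchy_translate_dense:
  assumes \<S>: "complete_sieve T N \<S>" and F: "ultrafilter F" "cauchy F"
    and A0: "eventually (\<lambda>x. x \<in> A0) F" and N0: "\<And>a x. a \<in> A0 \<Longrightarrow> x \<in> N0 \<Longrightarrow> a \<otimes> x \<in> N"
    and Q: "openin T Q" "Q \<noteq> {}" "Q \<subseteq> N0"
  obtains W A S where "openin T W" "W \<noteq> {}" "W \<subseteq> Q" "eventually (\<lambda>x. x \<in> A) F" "S \<in> \<S> n"
    "\<And>a x. a \<in> A \<Longrightarrow> x \<in> W \<Longrightarrow> a \<otimes> x \<in> S"
proof -
  obtain x0 where x0: "x0 \<in> Q" using Q by blast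
  then have x0c: "x0 \<in> carrier G" using Q openin_carrier by blast
  \<comment> \<open>\<open>Q\<close> is moved to a neighbourhood of \<open>\<one>\<close> and split
    into two factors: \<open>V\<close> for a difference of the Cauchy filter, \<open>V'\<close> for
    the displacement \<open>v\<close> forced by the sieve.\<close>
  define Q' where "Q' = {v \<in> topspace T. v \<otimes> x0 \<in> Q}"
  have "openin T Q'"
    unfolding Q'_def using x0c Q(1)
    by (intro openin_continuous_map_preimage[OF continuous_map_right_translation])
  moreover have "\<one> \<otimes> \<one> \<in> Q'" using x0 x0c by (simp add: Q'_def topspace_eq_carrier)
  ultimately obtain V V' where V: "openin T V" "\<one> \<in> V" "openin T V'" "\<one> \<in> V'"
    "\<And>a b. a \<in> V \<Longrightarrow> b \<in> V' \<Longrightarrow> a \<otimes> b \<in> Q'"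
    using mult_neighbourhoods[of Q' \<one> \<one>] by (metis one_closed)
  obtain A1 where A1: "A1 \<subseteq> carrier G" "eventually (\<lambda>x. x \<in> A1) F"
    "\<And>a b. a \<in> A1 \<Longrightarrow> b \<in> A1 \<Longrightarrow> inv a \<otimes> b \<in> V"
    using cauchyE[OF F(2) V(1,2)] by metis
  have "eventually (\<lambda>x. x \<in> A0 \<and> x \<in> A1) F" using A0 A1(2) by (rule eventually_conj)
  then obtain a1 where a1: "a1 \<in> A0" "a1 \<in> A1"
    using eventually_happens'[OF ultrafilter_nonbot[OF F(1)]] by blast
  have a1c: "a1 \<in> carrier G" using a1 A1 by blast
  \<comment> \<open>The sieve need not have a member around \<open>a1 \<otimes> x0\<close>, only one
    that meets the neighbourhood \<open>P\<close> of this point.\<close>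
  define P where "P = (\<lambda>z. a1 \<otimes> z) ` ((\<lambda>v. v \<otimes> x0) ` V') \<inter> N"
  have "a1 \<otimes> (\<one> \<otimes> x0) \<in> (\<lambda>z. a1 \<otimes> z) ` ((\<lambda>v. v \<otimes> x0) ` V')" using V(4) by blast
  then have "a1 \<otimes> x0 \<in> P" using N0[OF a1(1), of x0] x0 Q(3) x0c by (auto simp: P_def)
  moreover have "openin T P"
    using \<S> V(3) a1c x0c unfolding complete_sieve_def P_def
    by (intro openin_Int openin_left_translation openin_right_translation) auto
  ultimately obtain S where S: "S \<in> \<S> n" "S \<inter> P \<noteq> {}"
    using \<S> P_def unfolding complete_sieve_def by (metis empty_iff inf_le2)
  then obtain v where v: "v \<in> V'" "a1 \<otimes> (v \<otimes> x0) \<in> S" unfolding P_def by blast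
  have vc: "v \<in> carrier G" using v V(3) openin_carrier by blast
  define z where "z = a1 \<otimes> (v \<otimes> x0)"
  have zc: "z \<in> carrier G" using a1c vc x0c by (simp add: z_def)
  have oS: "openin T S" using \<S> S(1) unfolding complete_sieve_def by blast
  obtain B C where BC: "openin T B" "openin T C" "\<one> \<in> B" "z \<in> C"
    "\<And>a b. a \<in> B \<Longrightarrow> b \<in> C \<Longrightarrow> a \<otimes> b \<in> S"
    using mult_neighbourhoods[OF oS one_closed zc] v(2) zc by (metis l_one z_def)
  obtain A2 where A2: "A2 \<subseteq> carrier G" "eventually (\<lambda>x. x \<in> A2) F"
    "\<And>a b. a \<in> A2 \<Longrightarrow> b \<in> A2 \<Longrightarrow> a \<otimes> inv b \<in> B"
    using cauchyE[OF F(2) BC(1,3)] by metis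
  \<comment> \<open>The common element \<open>a2\<close> has two tasks: as a member of
    \<open>A1\<close> it keeps \<open>inv a2 \<otimes> z\<close> in \<open>Q\<close>, and as a
    member of \<open>A2\<close> it puts \<open>a \<otimes> inv a2\<close> into
    \<open>B\<close>.\<close>
  have "eventually (\<lambda>x. x \<in> A1 \<and> x \<in> A2) F" using A1(2) A2(2) by (rule eventually_conj)
  then obtain a2 where a2: "a2 \<in> A1" "a2 \<in> A2"
    using eventually_happens'[OF ultrafilter_nonbot[OF F(1)]] by blast
  have a2c: "a2 \<in> carrier G" using a2 A2 by blast
  let ?W = "Q \<inter> (\<lambda>y. inv a2 \<otimes> y) ` C"
  show ?thesis
  proof (rule that[of ?W A2 S])
    show "openin T ?W" using Q(1) BC(2) a2c by (intro openin_Int openin_left_translation) auto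
    have "(inv a2 \<otimes> a1) \<otimes> v \<in> Q'" using V(5) A1(3) a1 a2 v by blast
    then have "inv a2 \<otimes> z \<in> Q" using a1c a2c vc x0c by (simp add: Q'_def z_def m_assoc)
    then show "?W \<noteq> {}" using BC(4) by blast
    fix a x assume a: "a \<in> A2" and x: "x \<in> ?W"
    from x obtain y where y: "y \<in> C" "x = inv a2 \<otimes> y" by blast
    have "a \<otimes> x = (a \<otimes> inv a2) \<otimes> y"
      using y a A2(1) a2c openin_carrier[OF BC(2)] by (auto simp: m_assoc)
    then show "a \<otimes> x \<in> S" using BC(5) A2(3) a a2 y by auto
  qed (use A2 S in auto)
qed

text \<open>By category there is one \<open>p\<close> such that the translate of the filter by
  \<open>p\<close> contains a member of every level, hence converges; translating back gives the
  limit of \<open>F\<close>.\<close>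

lemma cauchy_limit:
  assumes reg: "regular_space T" and \<S>: "complete_sieve T N \<S>"
    and F: "ultrafilter F" "cauchy F"
  obtains l where "limitin T (\<lambda>x. x) l F"
proof -
  have N: "openin T N" "N \<noteq> {}" using \<S> unfolding complete_sieve_def by auto
  then obtain u where u: "u \<in> N" by blast
  then have uc: "u \<in> carrier G" using N openin_carrier by blast
  obtain A0 N1 where A0: "openin T A0" "openin T N1" "\<one> \<in> A0" "u \<in> N1"
    "\<And>a x. a \<in> A0 \<Longrightarrow> x \<in> N1 \<Longrightarrow> a \<otimes> x \<in> N"
    using mult_neighbourhoods[OF N(1) one_closed uc] u uc by (metis l_one)
  obtain A where A: "A \<subseteq> carrier G" "eventually (\<lambda>x. x \<in> A) F"
    "\<And>a b. a \<in> A \<Longrightarrow> b \<in> A \<Longrightarrow> a \<otimes> inv b \<in> A0"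
    using cauchyE[OF F(2) A0(1,3)] by metis
  then obtain c where c: "c \<in> A"
    using eventually_happens'[OF ultrafilter_nonbot[OF F(1)]] by blast
  then have cc: "c \<in> carrier G" using A by blast
  \<comment> \<open>The sieve is only rich inside \<open>N\<close>, so the filter is first moved
    near \<open>\<one>\<close>, where multiplication maps \<open>A0\<close> and \<open>N1\<close>
    into \<open>N\<close>.\<close>
  define F' where "F' = filtermap (\<lambda>x. x \<otimes> inv c) F"
  have F': "ultrafilter F'" "cauchy F'"
    unfolding F'_def using F cc by (auto intro: ultrafilter_filtermap cauchy_right_translation)
  have evA0: "eventually (\<lambda>x. x \<in> A0) F'"
    unfolding F'_def eventually_filtermap using A(2) by eventually_elim (use A(3) c in auto)
  let ?N = "N1 \<inter> N"
  \<comment> \<open>\<open>R n\<close> collects the points near which one set of \<open>F'\<close>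
    is translated into a single member of level \<open>n\<close>; it is open by construction and
    dense in \<open>?N\<close> by \<open>cauchy_translate_dense\<close>.\<close>
  define R where "R n = \<Union>{W. openin T W \<and> (\<exists>A S. eventually (\<lambda>x. x \<in> A) F' \<and> S \<in> \<S> n \<and>
      (\<forall>a\<in>A. \<forall>x\<in>W. a \<otimes> x \<in> S))}" for n
  have "openin T (R n)" for n unfolding R_def by (rule openin_Union) auto
  moreover have "Q \<inter> R n \<noteq> {}" if Q: "openin T Q" "Q \<noteq> {}" "Q \<subseteq> ?N" for n Q
  proof -
    obtain W A S where W: "openin T W" "W \<noteq> {}" "W \<subseteq> Q" "eventually (\<lambda>x. x \<in> A) F'" "S \<in> \<S> n"
      "\<And>a x. a \<in> A \<Longrightarrow> x \<in> W \<Longrightarrow> a \<otimes> x \<in> S"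
      using cauchy_translate_dense[OF \<S> F' evA0, of ?N Q n] A0(5) Q by blast
    then have "W \<subseteq> R n" unfolding R_def by blast
    with W show ?thesis by blast
  qed
  moreover have "openin T ?N" "?N \<noteq> {}" "?N \<subseteq> N" using A0 N u by auto
  ultimately obtain W p where W: "\<And>n. W n \<subseteq> ?N \<inter> R n" "p \<in> (\<Inter>n. W n)"
    using complete_sieve_Baire[OF reg \<S>, of ?N R] by metis
  have pR: "p \<in> R n" for n using W by blast
  have pc: "p \<in> carrier G" using W N openin_carrier by blast
  let ?F = "filtermap (\<lambda>x. x \<otimes> p) F'"
  have "\<exists>S\<in>\<S> n. eventually (\<lambda>x. x \<in> S) ?F" for n
  proof -
    obtain A S where AS: "eventually (\<lambda>x. x \<in> A) F'" "S \<in> \<S> n" "\<forall>a\<in>A. a \<otimes> p \<in> S"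
      using pR[of n] unfolding R_def by blast
    have "eventually (\<lambda>x. x \<in> S) ?F"
      unfolding eventually_filtermap using AS(1) by eventually_elim (use AS(3) in auto)
    with AS(2) show ?thesis by blast
  qed
  then obtain l where l: "limitin T (\<lambda>x. x) l ?F"
    by (rule complete_sieve_limit[OF \<S> ultrafilter_filtermap[OF F'(1)]])
  then have "limitin T (\<lambda>x. x \<otimes> inv c \<otimes> p) l F"
    by (simp add: F'_def limitin_filtermap)
  then have "limitin T (\<lambda>x. x \<otimes> inv c \<otimes> p \<otimes> (inv p \<otimes> c)) (l \<otimes> (inv p \<otimes> c)) F"
    using pc cc by (intro limitin_mult) (auto simp: topspace_eq_carrier)
  moreover have "eventually (\<lambda>x. x \<otimes> inv c \<otimes> p \<otimes> (inv p \<otimes> c) = x) F"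
    using A(2)
  proof eventually_elim
    case (elim x)
    then have x: "x \<in> carrier G" using A(1) by blast
    show ?case using x cc pc by (simp add: m_assoc mult_inv_cancel)
  qed
  ultimately have "limitin T (\<lambda>x. x) (l \<otimes> (inv p \<otimes> c)) F"
    by (rule limitin_transform_eventually[rotated])
  then show ?thesis by (rule that)
qed

text \<open>The sets \<open>W n\<close> are not small themselves, but they shrink to a compact set,
  which finitely many small translates of \<open>U\<close> cover. So \<open>F\<close> contains one
  left and one right translate of \<open>U\<close>: the left one bounds
  \<open>inv a \<otimes> b\<close>, the right one \<open>a \<otimes> inv b\<close>.\<close>

lemma cauchy_if_shrinking_translates:
  assumes \<S>: "complete_sieve T N \<S>" and W: "shrinking T \<S> W" "p \<in> (\<Inter>n. W n)"
    and F: "ultrafilter F"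
    and left: "\<And>n. \<exists>g\<in>carrier G. eventually (\<lambda>x. x \<in> (\<lambda>y. g \<otimes> y) ` W n) F"
    and right: "\<And>n. \<exists>g\<in>carrier G. eventually (\<lambda>x. x \<in> (\<lambda>y. y \<otimes> g) ` W n) F"
  shows "cauchy F"
  unfolding cauchy_def
proof (intro allI impI)
  fix V assume V: "openin T V \<and> \<one> \<in> V"
  then obtain U where U: "openin T U" "\<one> \<in> U"
    "\<And>a b. a \<in> U \<Longrightarrow> b \<in> U \<Longrightarrow> a \<otimes> inv b \<in> V \<and> inv a \<otimes> b \<in> V"
    using quotient_neighbourhood by metis
  have Uc: "U \<subseteq> carrier G" using U openin_carrier by blast
  let ?K = "\<Inter>n. W n"
  have K: "compactin T ?K" using compactin_shrinking[OF \<S> W] .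
  have Kc: "?K \<subseteq> carrier G" using compactin_subset_topspace[OF K] by (simp add: topspace_eq_carrier)
  have ev: "\<exists>h\<in>(\<lambda>g y. g \<otimes> y) ` carrier G. eventually (\<lambda>x. x \<in> h ` W n) F"
    "\<exists>h\<in>(\<lambda>g y. y \<otimes> g) ` carrier G. eventually (\<lambda>x. x \<in> h ` W n) F" for n
    using left[of n] right[of n] by auto
  have K1: "k \<in> (\<lambda>y. k \<otimes> y) ` U" "k \<in> (\<lambda>y. y \<otimes> k) ` U" if "k \<in> ?K" for k
  proof -
    have "k \<in> carrier G" using Kc that by blast
    then show "k \<in> (\<lambda>y. k \<otimes> y) ` U" "k \<in> (\<lambda>y. y \<otimes> k) ` U"
      using U(2) by (auto intro: image_eqI[of _ _ "\<one>"])
  qed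
  have oK: "openin T ((\<lambda>y. k \<otimes> y) ` U)" "openin T ((\<lambda>y. y \<otimes> k) ` U)" if "k \<in> ?K" for k
  proof -
    have "k \<in> carrier G" using Kc that by blast
    then show "openin T ((\<lambda>y. k \<otimes> y) ` U)" "openin T ((\<lambda>y. y \<otimes> k) ` U)"
      using U(1) by (auto intro: openin_left_translation openin_right_translation)
  qed
  obtain h k where hk: "h \<in> (\<lambda>g y. g \<otimes> y) ` carrier G" "k \<in> ?K"
    "eventually (\<lambda>x. x \<in> h ` (\<lambda>y. k \<otimes> y) ` U) F"
    by (rule shrinking_ultrafilter_cover[OF \<S> W F oK(1) K1(1) ev(1)])
  obtain c where c: "c \<in> carrier G" "eventually (\<lambda>x. x \<in> (\<lambda>y. c \<otimes> y) ` U) F"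
  proof -
    obtain g where g: "g \<in> carrier G" "h = (\<lambda>y. g \<otimes> y)" using hk(1) by blast
    have k: "k \<in> carrier G" using hk(2) Kc by blast
    have "h ` (\<lambda>y. k \<otimes> y) ` U = (\<lambda>y. (g \<otimes> k) \<otimes> y) ` U"
      unfolding g(2) image_image using k Uc g(1) by (intro image_cong) (auto simp: m_assoc)
    with hk(3) show ?thesis using g(1) k by (intro that[of "g \<otimes> k"]) auto
  qed
  obtain h k where hk: "h \<in> (\<lambda>g y. y \<otimes> g) ` carrier G" "k \<in> ?K"
    "eventually (\<lambda>x. x \<in> h ` (\<lambda>y. y \<otimes> k) ` U) F"
    by (rule shrinking_ultrafilter_cover[OF \<S> W F oK(2) K1(2) ev(2)])
  obtain d where d: "d \<in> carrier G" "eventually (\<lambda>x. x \<in> (\<lambda>y. y \<otimes> d) ` U) F"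
  proof -
    obtain g where g: "g \<in> carrier G" "h = (\<lambda>y. y \<otimes> g)" using hk(1) by blast
    have k: "k \<in> carrier G" using hk(2) Kc by blast
    have "h ` (\<lambda>y. y \<otimes> k) ` U = (\<lambda>y. y \<otimes> (k \<otimes> g)) ` U"
      unfolding g(2) image_image using k Uc g(1) by (intro image_cong) (auto simp: m_assoc)
    with hk(3) show ?thesis using g(1) k by (intro that[of "k \<otimes> g"]) auto
  qed
  let ?A = "(\<lambda>y. c \<otimes> y) ` U \<inter> (\<lambda>y. y \<otimes> d) ` U"
  have "a \<otimes> inv b \<in> V \<and> inv a \<otimes> b \<in> V" if a: "a \<in> ?A" and b: "b \<in> ?A" for a b
  proof
    obtain a' b' where ab: "a' \<in> U" "b' \<in> U" "a = a' \<otimes> d" "b = b' \<otimes> d" using a b by blast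
    have car: "a' \<in> carrier G" "b' \<in> carrier G" using ab Uc by auto
    have "a \<otimes> inv b = a' \<otimes> inv b'"
      using ab(3,4) car d(1) by (simp add: inv_mult_group m_assoc mult_inv_cancel)
    then show "a \<otimes> inv b \<in> V" using U(3) ab by simp
  next
    obtain a' b' where ab: "a' \<in> U" "b' \<in> U" "a = c \<otimes> a'" "b = c \<otimes> b'" using a b by blast
    have car: "a' \<in> carrier G" "b' \<in> carrier G" using ab Uc by auto
    have "inv a \<otimes> b = inv a' \<otimes> b'"
      using ab(3,4) car c(1) by (simp add: inv_mult_group m_assoc mult_inv_cancel)
    then show "inv a \<otimes> b \<in> V" using U(3) ab by simp
  qed
  moreover have "eventually (\<lambda>x. x \<in> ?A) F"
    using c(2) d(2) by eventually_elim blast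
  moreover have "?A \<subseteq> carrier G" using Uc c(1) by auto
  ultimately show "\<exists>A\<subseteq>carrier G. eventually (\<lambda>x. x \<in> A) F \<and>
      (\<forall>a\<in>A. \<forall>b\<in>A. a \<otimes> inv b \<in> V \<and> inv a \<otimes> b \<in> V)"
    by (intro exI[of _ ?A]) auto
qed

end

section \<open>Remainders\<close>

lemma Hausdorff_compactification_dense:
  assumes "Hausdorff_compactification X B e" "openin B Q" "Q \<noteq> {}"
  obtains x where "x \<in> topspace X" "e x \<in> Q"
proof -
  obtain q where q: "q \<in> Q" using assms by blast
  then have "q \<in> B closure_of (e ` topspace X)"
    using assms openin_subset unfolding Hausdorff_compactification_def by fastforce
  then obtain y where "y \<in> e ` topspace X" "y \<in> Q"
    using assms(2) q unfolding in_closure_of by blast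
  then show ?thesis using that by blast
qed

lemma Hausdorff_compactification_continuous:
  "Hausdorff_compactification X B e \<Longrightarrow> continuous_map X B e"
  unfolding Hausdorff_compactification_def embedding_map_def
  using continuous_map_in_subtopology homeomorphic_imp_continuous_map by blast

lemma Hausdorff_compactification_regular:
  "Hausdorff_compactification X B e \<Longrightarrow> regular_space B"
  by (simp add: Hausdorff_compactification_def compact_Hausdorff_imp_regular_space)

text \<open>An open set of \<open>B\<close> inside the image of the group would contain the closure
  of a smaller open set, giving a compact neighbourhood in the group and so local compactness by
  homogeneity.\<close>

lemma (in paratopological_group) remainder_dense:
  assumes cpt: "Hausdorff_compactification T B e" and nlc: "\<not> locally_compact_space T"
    and Q: "openin B Q" "Q \<noteq> {}"
  shows "Q - e ` topspace T \<noteq> {}"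
proof
  assume empty: "Q - e ` topspace T = {}"
  obtain q where "q \<in> Q" using Q by blast
  then obtain V where V: "openin B V" "q \<in> V" "B closure_of V \<subseteq> Q"
    by (rule regular_space_shrink[OF Hausdorff_compactification_regular[OF cpt] Q(1)])
  have e: "homeomorphic_map T (subtopology B (e ` topspace T)) e"
    using cpt by (simp add: Hausdorff_compactification_def embedding_map_def)
  let ?K = "{x \<in> topspace T. e x \<in> B closure_of V}"
  have "e ` ?K = B closure_of V" using V(3) empty by auto
  moreover have "compactin B (B closure_of V)"
    using cpt by (simp add: Hausdorff_compactification_def closedin_compact_space)
  ultimately have "compactin (subtopology B (e ` topspace T)) (e ` ?K)"
    by (auto simp: compactin_subtopology)
  then have "compactin T ?K"
    using homeomorphic_map_compactness[OF e, of ?K] by auto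
  moreover have "openin T {x \<in> topspace T. e x \<in> V}"
    using Hausdorff_compactification_continuous[OF cpt] V(1) by (rule openin_continuous_map_preimage)
  moreover have "{x \<in> topspace T. e x \<in> V} \<noteq> {}"
    using Hausdorff_compactification_dense[OF cpt V(1)] V(2) by blast
  moreover have "V \<subseteq> B closure_of V" using V(1) by (simp add: closure_of_subset openin_subset)
  ultimately have "locally_compact_space T"
    by (intro locally_compact_space_if_compact_neighbourhood[of "{x \<in> topspace T. e x \<in> V}" ?K]) auto
  with nlc show False ..
qed

text \<open>An ultrafilter with a member of every level converges in the compact space
  \<open>B\<close>, to a point of all \<open>P n\<close>. The failure of the Baire property keeps
  this point out of the remainder, so it comes from \<open>X\<close>.\<close>

lemma complete_sieve_if_remainder_not_Baire:
  assumes cpt: "Hausdorff_compactification X B e" and nB: "\<not> Baire_space (remainder X B e)"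
    and dense: "\<And>Q. openin B Q \<Longrightarrow> Q \<noteq> {} \<Longrightarrow> Q - e ` topspace X \<noteq> {}"
  obtains N \<S> where "complete_sieve X N \<S>"
proof -
  define Y where "Y = topspace B - e ` topspace X"
  have rem: "remainder X B e = subtopology B Y" by (simp add: remainder_def Y_def)
  have tY: "topspace (subtopology B Y) = Y" by (auto simp: Y_def)
  obtain U where U: "\<And>n. openin (subtopology B Y) (U n)"
      "\<And>n. subtopology B Y closure_of U n = Y"
    and nd: "subtopology B Y closure_of (\<Inter>n::nat. U n) \<noteq> Y"
    using nB unfolding Baire_space_def rem tY by blast
  have "subtopology B Y closure_of (\<Inter>n. U n) \<subseteq> Y"
    using closure_of_subset_topspace[of "subtopology B Y"] tY by blast
  then obtain y where y: "y \<in> Y" "y \<notin> subtopology B Y closure_of (\<Inter>n. U n)" using nd by blast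
  then obtain D where D: "openin (subtopology B Y) D" "y \<in> D" "D \<inter> (\<Inter>n. U n) = {}"
    unfolding in_closure_of tY by blast
  obtain O1 where O1: "openin B O1" "D = O1 \<inter> Y" using D(1) unfolding openin_subtopology by blast
  have "\<forall>n. \<exists>V. openin B V \<and> U n = V \<inter> Y" using U(1) unfolding openin_subtopology by blast
  then obtain V where V: "\<And>n. openin B (V n)" "\<And>n. U n = V n \<inter> Y" by metis
  \<comment> \<open>Extensions to \<open>B\<close> of the dense sets, cut down to an open set
    \<open>O1\<close> whose trace \<open>D\<close> on the remainder misses their
    intersection.\<close>
  define P where "P n = O1 \<inter> V n" for n
  have oP: "openin B (P n)" for n using O1 V by (simp add: P_def openin_Int)
  have P_Y: "l \<notin> Y" if "\<And>n. l \<in> P n" for l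
  proof
    assume "l \<in> Y"
    then have "l \<in> D \<inter> (\<Inter>n. U n)" using that O1(2) V(2) by (auto simp: P_def)
    then show False using D(3) by blast
  qed
  have P_dense: "Q \<inter> P n \<noteq> {}" if Q: "openin B Q" "Q \<noteq> {}" "Q \<subseteq> O1" for Q n
  proof -
    obtain z where z: "z \<in> Q" "z \<in> Y" 
      using dense[OF Q(1,2)] openin_subset[OF Q(1)] by (auto simp: Y_def)
    have "openin (subtopology B Y) (Q \<inter> Y)" using Q(1) unfolding openin_subtopology by blast
    moreover have "z \<in> subtopology B Y closure_of U n" using U(2) z by simp
    ultimately obtain w where "w \<in> U n" "w \<in> Q \<inter> Y" using z unfolding in_closure_of by blast
    then show ?thesis using V(2) Q(3) by (auto simp: P_def)
  qed
  define N where "N = {x \<in> topspace X. e x \<in> O1}"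
  \<comment> \<open>The closure is taken in \<open>B\<close>, not in \<open>X\<close>: it has to
    contain limits that are not yet known to lie in the image of \<open>X\<close>.\<close>
  define \<S> where "\<S> n = {S. openin X S \<and> B closure_of (e ` S) \<subseteq> P n}" for n
  note cont = Hausdorff_compactification_continuous[OF cpt]
  have emb: "embedding_map X B e" using cpt by (simp add: Hausdorff_compactification_def)
  have "complete_sieve X N \<S>"
    unfolding complete_sieve_def
  proof (intro conjI allI impI ballI)
    show "openin X N" unfolding N_def using cont O1(1) by (rule openin_continuous_map_preimage)
    show "N \<noteq> {}"
      using Hausdorff_compactification_dense[OF cpt O1(1)] D(2) O1(2) unfolding N_def by blast
    show "openin X S" if "S \<in> \<S> n" for n S using that by (simp add: \<S>_def)
  next
    fix n Q assume "openin X Q \<and> Q \<subseteq> N \<and> Q \<noteq> {}"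
    then have Q: "openin X Q" "Q \<subseteq> N" and "Q \<noteq> {}" by auto
    then obtain q where q: "q \<in> Q" by blast
    obtain Q' where Q': "openin B Q'" "\<And>x. x \<in> topspace X \<Longrightarrow> e x \<in> Q' \<longleftrightarrow> x \<in> Q"
      using emb Q(1) by (rule embedding_map_openE) blast
    have "e q \<in> Q' \<inter> O1" using q Q(2) Q'(2) by (auto simp: N_def)
    moreover have "openin B (Q' \<inter> O1)" using Q'(1) O1(1) by (rule openin_Int)
    \<comment> \<open>The point \<open>z\<close> may lie in the remainder; only the neighbourhood
      \<open>R\<close> found by regularity is sure to meet the image of \<open>X\<close>.\<close>
    ultimately obtain z where z: "z \<in> Q' \<inter> O1 \<inter> P n" using P_dense[of "Q' \<inter> O1" n] by blast
    have "openin B (Q' \<inter> O1 \<inter> P n)" using Q'(1) O1(1) oP by (intro openin_Int)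
    then obtain R where R: "openin B R" "z \<in> R" "B closure_of R \<subseteq> Q' \<inter> O1 \<inter> P n"
      using z by (rule regular_space_shrink[OF Hausdorff_compactification_regular[OF cpt]])
    obtain x where x: "x \<in> topspace X" "e x \<in> R"
      using Hausdorff_compactification_dense[OF cpt R(1)] R(2) by blast
    let ?S = "{x \<in> topspace X. e x \<in> R}"
    have "B closure_of (e ` ?S) \<subseteq> B closure_of R" by (rule closure_of_mono) auto
    then have "?S \<in> \<S> n"
      using R(3) openin_continuous_map_preimage[OF cont R(1)] by (auto simp: \<S>_def)
    moreover have "x \<in> Q"
      using x R(3) Q'(2) closure_of_subset[OF openin_subset[OF R(1)]] by blast
    ultimately show "\<exists>S\<in>\<S> n. S \<inter> Q \<noteq> {}" using x by (intro bexI[of _ ?S]) auto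
  next
    fix F :: "'a filter" assume "ultrafilter F \<and> (\<forall>n. \<exists>S\<in>\<S> n. eventually (\<lambda>x. x \<in> S) F)"
    then have F: "ultrafilter F" and "\<forall>n. \<exists>S. S \<in> \<S> n \<and> eventually (\<lambda>x. x \<in> S) F"
      by (simp_all add: Bex_def)
    then obtain S where S: "\<And>n. S n \<in> \<S> n" "\<And>n. eventually (\<lambda>x. x \<in> S n) F" by metis
    have Ssub: "S n \<subseteq> topspace X" for n using S(1)[of n] by (auto simp: \<S>_def openin_subset)
    have evX: "eventually (\<lambda>x. x \<in> topspace X) F"
      by (rule eventually_mono[OF S(2)[of 0]]) (use Ssub in blast)
    have "compactin B (topspace B)"
      using cpt by (simp add: Hausdorff_compactification_def compact_space_def)
    moreover have "eventually (\<lambda>x. e x \<in> topspace B) F"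
      using evX by eventually_elim (use cont in \<open>auto simp: continuous_map_def\<close>)
    ultimately obtain l where l: "l \<in> topspace B" "limitin B e l F"
      by (rule ultrafilter_limit_compactin[OF F])
    have "l \<in> P n" for n
    proof -
      have "eventually (\<lambda>x. e x \<in> e ` S n) F" using S(2)[of n] by eventually_elim auto
      then have "l \<in> B closure_of (e ` S n)"
        by (rule limitin_closure_of[OF ultrafilter_nonbot[OF F] l(2)])
      then show ?thesis using S(1)[of n] by (auto simp: \<S>_def)
    qed
    then have "l \<notin> Y" by (rule P_Y)
    then obtain x where "x \<in> topspace X" "l = e x" using l(1) by (auto simp: Y_def)
    then show "\<exists>l. limitin X (\<lambda>x. x) l F" using limitin_embedding_map[OF emb _ _ evX] l(2) by blast
  qed
  then show ?thesis by (rule that)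
qed

text \<open>The image of the group is the intersection of the open sets \<open>E n\<close>, so the
  remainder is the union of their compact complements. Completeness for Cauchy ultrafilters gives
  the inclusion \<open>E_sub\<close>.\<close>

lemma (in topological_group) sigma_compact_remainder:
  assumes reg: "regular_space T" and \<S>: "complete_sieve T N \<S>"
    and cpt: "Hausdorff_compactification T B e"
  shows "sigma_compact_space (remainder T B e)"
proof -
  obtain W p where W: "shrinking T \<S> W" and p: "p \<in> (\<Inter>n. W n)"
    by (rule complete_sieve_shrinking[OF reg \<S>])
  have oW: "openin T (W n)" for n using W by (auto simp: shrinking_def)
  have pc: "p \<in> carrier G" using p oW openin_carrier by blast
  note cont = Hausdorff_compactification_continuous[OF cpt]
  have emb: "embedding_map T B e" using cpt by (simp add: Hausdorff_compactification_def)
  define small where "small n V \<longleftrightarrow> (\<exists>g\<in>carrier G. \<exists>h\<in>carrier G.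
      \<forall>x\<in>topspace T. e x \<in> V \<longrightarrow> x \<in> (\<lambda>y. g \<otimes> y) ` W n \<inter> (\<lambda>y. y \<otimes> h) ` W n)" for n V
  define E where "E n = \<Union>{V. openin B V \<and> small n V}" for n
  have oE: "openin B (E n)" for n unfolding E_def by (rule openin_Union) auto
  have E_sup: "e x \<in> E n" if x: "x \<in> topspace T" for x n
  proof -
    have xc: "x \<in> carrier G" using x by (simp add: topspace_eq_carrier)
    \<comment> \<open>These translations carry \<open>p\<close> to \<open>x\<close>; as
      \<open>p\<close> lies in every \<open>W n\<close>, both translates contain
      \<open>x\<close>.\<close>
    let ?g = "x \<otimes> inv p" and ?h = "inv p \<otimes> x"
    let ?A = "(\<lambda>y. ?g \<otimes> y) ` W n \<inter> (\<lambda>y. y \<otimes> ?h) ` W n"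
    have oA: "openin T ?A"
      using xc pc oW by (intro openin_Int openin_left_translation openin_right_translation) auto
    obtain V where V: "openin B V" "\<And>z. z \<in> topspace T \<Longrightarrow> e z \<in> V \<longleftrightarrow> z \<in> ?A"
      using emb oA by (rule embedding_map_openE) blast
    have "small n V" unfolding small_def using V(2) xc pc by (intro bexI[of _ ?g] bexI[of _ ?h]) auto
    moreover have "x \<in> ?A"
      using xc pc p by (auto intro!: image_eqI[of _ _ p] simp: m_assoc mult_inv_cancel)
    then have "e x \<in> V" using V(2) x by blast
    ultimately show ?thesis using V(1) unfolding E_def by blast
  qed
  have E_sub: "y \<in> e ` topspace T" if y: "\<And>n. y \<in> E n" for y
  proof -
    have yB: "y \<in> topspace B" using y oE openin_subset by blast
    \<comment> \<open>The trace on the group of the neighbourhoods of \<open>y\<close>, proper by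
      density. Ultrafilters below it converge to \<open>y\<close> in \<open>B\<close> and are
      Cauchy, since \<open>y\<close> lies in every \<open>E n\<close>.\<close>
    let ?F = "inf (filtercomap e (nhdsin B y)) (principal (topspace T))"
    have ev: "eventually R ?F" if "openin B V" "y \<in> V" "\<And>x. x \<in> topspace T \<Longrightarrow> e x \<in> V \<Longrightarrow> R x" for V R
      unfolding eventually_inf_principal eventually_filtercomap eventually_nhdsin
      using that by (intro exI[of _ "\<lambda>z. z \<in> V"]) auto
    have "?F \<noteq> bot"
    proof
      assume "?F = bot"
      then obtain Z where "eventually Z (nhdsin B y)" and Z: "\<And>x. Z (e x) \<Longrightarrow> x \<notin> topspace T"
        unfolding trivial_limit_def eventually_inf_principal eventually_filtercomap by auto
      then obtain V where V: "openin B V" "y \<in> V" "\<And>z. z \<in> V \<Longrightarrow> Z z"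
        using yB unfolding eventually_nhdsin by auto
      then show False using Hausdorff_compactification_dense[OF cpt V(1)] Z by blast
    qed
    then obtain F where F: "F \<le> ?F" "ultrafilter F" by (rule ultrafilter_exists)
    have evF: "eventually R F"
      if "openin B V" "y \<in> V" "\<And>x. x \<in> topspace T \<Longrightarrow> e x \<in> V \<Longrightarrow> R x" for V R
      using filter_leD[OF F(1) ev[OF that]] .
    have lim_y: "limitin B e y F"
      unfolding limitin_def
    proof (intro conjI allI impI)
      fix V assume "openin B V \<and> y \<in> V"
      then show "eventually (\<lambda>x. e x \<in> V) F" by (intro evF[of V]) auto
    qed (fact yB)
    have small_F: "\<exists>g\<in>carrier G. \<exists>h\<in>carrier G. eventually (\<lambda>x. x \<in> (\<lambda>y. g \<otimes> y) ` W n) F \<and>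
        eventually (\<lambda>x. x \<in> (\<lambda>y. y \<otimes> h) ` W n) F" for n
    proof -
      obtain V where V: "openin B V" "y \<in> V" "small n V" using y[of n] unfolding E_def by blast
      then obtain g h where gh: "g \<in> carrier G" "h \<in> carrier G"
        "\<And>x. x \<in> topspace T \<Longrightarrow> e x \<in> V \<Longrightarrow> x \<in> (\<lambda>y. g \<otimes> y) ` W n \<inter> (\<lambda>y. y \<otimes> h) ` W n"
        unfolding small_def by blast
      have "eventually (\<lambda>x. x \<in> (\<lambda>y. g \<otimes> y) ` W n) F" "eventually (\<lambda>x. x \<in> (\<lambda>y. y \<otimes> h) ` W n) F"
        by (rule evF[OF V(1,2)], use gh(3) in blast)+
      with gh(1,2) show ?thesis by blast
    qed
    have "cauchy F"
      by (rule cauchy_if_shrinking_translates[OF \<S> W p F(2)]) (use small_F in blast)+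
    then obtain l where l: "limitin T (\<lambda>x. x) l F" by (rule cauchy_limit[OF reg \<S> F(2)])
    \<comment> \<open>The limit in the group and the limit \<open>y\<close> in \<open>B\<close>
      coincide by uniqueness of limits in \<open>B\<close>.\<close>
    have "limitin B e (e l) F" using continuous_map_limit[OF cont l] by (simp add: o_def)
    then have "y = e l"
      using limitin_Hausdorff_unique[OF lim_y _ ultrafilter_nonbot[OF F(2)]] cpt
      by (simp add: Hausdorff_compactification_def)
    then show ?thesis using limitin_topspace[OF l] by blast
  qed
  let ?Y = "topspace B - e ` topspace T"
  have "compactin (remainder T B e) (topspace B - E n)" for n
  proof -
    have "closedin B (topspace B - E n)" using oE by blast
    then have "compactin B (topspace B - E n)"
      using cpt by (simp add: Hausdorff_compactification_def closedin_compact_space)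
    then show ?thesis using E_sup unfolding remainder_def by (auto simp: compactin_subtopology)
  qed
  moreover have "(\<Union>n. topspace B - E n) = topspace (remainder T B e)"
    using E_sup E_sub unfolding remainder_def by auto
  ultimately show ?thesis
    unfolding sigma_compact_space_def by (intro exI[of _ "\<lambda>n. topspace B - E n"]) blast
qed

theorem corollary3p3:
  fixes G :: "('a, 'm) monoid_scheme" (structure) and T :: "'a topology"
  assumes "k_gentle_paratopological_group G T"
    and "Tychonoff_space T"
    and "\<not> locally_compact_space T"
  shows "(\<forall>(B :: 'b topology) e. Hausdorff_compactification T B e \<longrightarrow>
            Baire_space (remainder T B e)) \<or>
         (\<forall>(B :: 'c topology) e. Hausdorff_compactification T B e \<longrightarrow>
            sigma_compact_space (remainder T B e))"
\<comment> \<open>The two counterexamples \<open>C\<close> and \<open>B\<close> are unrelated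
  compactifications: \<open>B\<close> supplies the sieve on \<open>T\<close>, which is then used to
  contradict the choice of \<open>C\<close>.\<close>
proof (rule disjCI)
  interpret k_gentle_paratopological_group G T by (fact assms(1))
  have H: "Hausdorff_space T" and reg: "regular_space T"
    using assms(2) by (auto simp: Tychonoff_space_def completely_regular_imp_regular_space)
  assume "\<not> (\<forall>(B :: 'c topology) e. Hausdorff_compactification T B e \<longrightarrow>
            sigma_compact_space (remainder T B e))"
  then obtain C :: "'c topology" and f where C: "Hausdorff_compactification T C f"
    "\<not> sigma_compact_space (remainder T C f)" by blast
  show "\<forall>(B :: 'b topology) e. Hausdorff_compactification T B e \<longrightarrow> Baire_space (remainder T B e)"
  proof (intro allI impI, rule ccontr)
    fix B :: "'b topology" and e
    assume B: "Hausdorff_compactification T B e" and "\<not> Baire_space (remainder T B e)"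
    then obtain N \<S> where \<S>: "complete_sieve T N \<S>"
      using complete_sieve_if_remainder_not_Baire remainder_dense[OF B assms(3)] by metis
    interpret topological_group G T
      by unfold_locales (rule continuous_map_inv[OF H reg \<S>])
    show False using sigma_compact_remainder[OF reg \<S> C(1)] C(2) by contradiction
  qed
qed

end
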